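(* Let $W$, $Z$ and $\Delta_F$ be chosen such that $$\|G\| = \| \delta_F + \Delta_F \delta_P\mathcal{K}^{-1}\delta_R \| =\rho <1 .$$ Then the two-grid iteration (coarse-grid correction followed by F-relaxation) converges, and for every $k\ge 1$ the errors and residuals satisfy $$\| \mathbf{e}_k \| \leq \rho^{k-1} \left\|\begin{bmatrix} \delta_F - \widehat{W}\mathcal{K}^{-1}\delta_R \\ -\mathcal{K}^{-1} \delta_R \end{bmatrix}\right\| \, \left\| \begin{bmatrix} I & - W \end{bmatrix} \right\| \, \|\mathbf{e}_0\|,$$ $$\| \mathbf{r}_k \| \leq \rho^{k-1} \left\|\begin{bmatrix} \Delta_F^{-1} - A_{ff} \\ -(Z\Delta_F^{-1}+A_{cf}) \end{bmatrix}\right\| \, \left\| \begin{bmatrix} \Delta_F(I- \delta_P\mathcal{K}^{-1}Z) &-\Delta_F\delta_P\mathcal{K}^{-1} \end{bmatrix}\right\| \, \|\mathbf{r}_0\| .$$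
   Context: All norms are Euclidean ($\ell^2$) vector norms and induced operator norms. Let $A\in\mathbb{R}^{n\times n}$ be nonsingular. The $n$ unknowns are partitioned into $n_f$ F-points and $n_c$ C-points, $n=n_f+n_c$, ordered with F-points first, and $$A = \begin{bmatrix} A_{ff} & A_{fc} \\ A_{cf} & A_{cc}\end{bmatrix},\qquad P = \begin{bmatrix} W \\ I\end{bmatrix},\qquad R = \begin{bmatrix} Z & I\end{bmatrix},$$ with $W\in\mathbb{R}^{n_f\times n_c}$ (interpolation) and $Z\in\mathbb{R}^{n_c\times n_f}$ (restriction). The coarse-grid operator is $\mathcal{K} = RAP = ZA_{ff}W + A_{cf}W + ZA_{fc}+A_{cc}$. The matrix $\Delta_F\in\mathbb{R}^{n_f\times n_f}$ is an approximation to $A_{ff}^{-1}$. The matrices $A_{ff}$, $\Delta_F$ and $\mathcal{K}$ are assumed nonsingular. Define $$\delta_F = I-\Delta_FA_{ff},\quad \delta_P = A_{ff}W+A_{fc},\quad \delta_R = ZA_{ff}+A_{cf},\quad \widehat{W} = \delta_F W - \Delta_FA_{fc},$$ $$G = \delta_F + \Delta_F\delta_P\mathcal{K}^{-1} \delta_R .$$ The iteration for $A\mathbf{x}=\mathbf{b}$: one step from $\mathbf{x}_k$ to $\mathbf{x}_{k+1}$ consists of the coarse-grid correction $\mathbf{x}\leftarrow \mathbf{x}+P\mathcal{K}^{-1}R(\mathbf{b}-A\mathbf{x})$ followed by the F-relaxation $\mathbf{x}\leftarrow\mathbf{x}+\begin{bmatrix}\Delta_F&0\\0&0\end{bmatrix}(\mathbf{b}-A\mathbf{x})$.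 The error is $\mathbf{e}_k = A^{-1}\mathbf{b}-\mathbf{x}_k$ and the residual is $\mathbf{r}_k=\mathbf{b}-A\mathbf{x}_k$. Thus $\mathbf{e}_{k+1}=\mathcal{E}\mathbf{e}_k$ and $\mathbf{r}_{k+1}=\mathcal{R}\mathbf{r}_k$, where $$\mathcal{E}=\left(I-\begin{bmatrix}\Delta_F&0\\0&0\end{bmatrix}A\right)\left(I-P\mathcal{K}^{-1}RA\right),\qquad \mathcal{R}=A\mathcal{E}A^{-1}.$$ *)

theory Defs
  imports "HOL-Analysis.Analysis"
begin

text \<open>The unknowns are indexed by the sum type \<open>'f + 'c\<close>: \<open>Inl\<close> for F-points, \<open>Inr\<close> for C-points.
  Recall that \<open>real^'n^'m\<close> has rows indexed by \<open>'m\<close> and columns by \<open>'n\<close>.\<close>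

definition block_row :: "real^'p^'m \<Rightarrow> real^'q^'m \<Rightarrow> real^('p + 'q)^'m" where
  "block_row B C = (\<chi> i j. case j of Inl k \<Rightarrow> B $ i $ k | Inr k \<Rightarrow> C $ i $ k)"

definition block_col :: "real^'n^'p \<Rightarrow> real^'n^'q \<Rightarrow> real^'n^('p + 'q)" where
  "block_col B C = (\<chi> i j. case i of Inl k \<Rightarrow> B $ k $ j | Inr k \<Rightarrow> C $ k $ j)"

definition block_mat ::
  "real^'f^'f \<Rightarrow> real^'c^'f \<Rightarrow> real^'f^'c \<Rightarrow> real^'c^'c \<Rightarrow> real^('f + 'c)^('f + 'c)" where
  "block_mat M11 M12 M21 M22 = block_col (block_row M11 M12) (block_row M21 M22)"

definition A_ff :: "real^('f::finite + 'c::finite)^('f + 'c) \<Rightarrow> real^'f^'f" where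
  "A_ff A = (\<chi> i j. A $ Inl i $ Inl j)"

definition A_fc :: "real^('f + 'c)^('f + 'c) \<Rightarrow> real^'c^'f" where
  "A_fc A = (\<chi> i j. A $ Inl i $ Inr j)"

definition A_cf :: "real^('f + 'c)^('f + 'c) \<Rightarrow> real^'f^'c" where
  "A_cf A = (\<chi> i j. A $ Inr i $ Inl j)"

definition A_cc :: "real^('f::finite + 'c::finite)^('f + 'c) \<Rightarrow> real^'c^'c" where
  "A_cc A = (\<chi> i j. A $ Inr i $ Inr j)"

text \<open>\<open>norm\<close> on the matrix type is the Frobenius norm; the norm induced by the Euclidean vector
  norms is \<open>onorm\<close> of the associated linear map.\<close>

abbreviation opnorm :: "real^'n^'m \<Rightarrow> real" where
  "opnorm M \<equiv> onorm (\<lambda>x. M *v x)"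

definition interp :: "real^'c^'f \<Rightarrow> real^'c^('f + 'c)" where
  "interp W = block_col W (mat 1)"

definition restr :: "real^'f^'c \<Rightarrow> real^('f + 'c)^'c" where
  "restr Z = block_row Z (mat 1)"

definition coarse_op :: "real^('f + 'c)^('f + 'c) \<Rightarrow> real^'c^'f \<Rightarrow> real^'f^'c \<Rightarrow> real^'c^'c" where
  "coarse_op A W Z = restr Z ** A ** interp W"

definition delta_F :: "real^('f::finite + 'c::finite)^('f + 'c) \<Rightarrow> real^'f^'f \<Rightarrow> real^'f^'f" where
  "delta_F A \<Delta>F = mat 1 - \<Delta>F ** A_ff A"

definition delta_P :: "real^('f + 'c)^('f + 'c) \<Rightarrow> real^'c^'f \<Rightarrow> real^'c^'f" where
  "delta_P A W = A_ff A ** W + A_fc A"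

definition delta_R :: "real^('f + 'c)^('f + 'c) \<Rightarrow> real^'f^'c \<Rightarrow> real^'f^'c" where
  "delta_R A Z = Z ** A_ff A + A_cf A"

definition W_hat :: "real^('f + 'c)^('f + 'c) \<Rightarrow> real^'f^'f \<Rightarrow> real^'c^'f \<Rightarrow> real^'c^'f" where
  "W_hat A \<Delta>F W = delta_F A \<Delta>F ** W - \<Delta>F ** A_fc A"

definition G_mat ::
  "real^('f + 'c)^('f + 'c) \<Rightarrow> real^'f^'f \<Rightarrow> real^'c^'f \<Rightarrow> real^'f^'c \<Rightarrow> real^'f^'f" where
  "G_mat A \<Delta>F W Z =
     delta_F A \<Delta>F + \<Delta>F ** delta_P A W ** matrix_inv (coarse_op A W Z) ** delta_R A Z"

definition coarse_correction ::
  "real^('f + 'c)^('f + 'c) \<Rightarrow> real^('f + 'c) \<Rightarrow> real^'c^'f \<Rightarrow> real^'f^'c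
     \<Rightarrow> real^('f + 'c) \<Rightarrow> real^('f + 'c)" where
  "coarse_correction A b W Z x =
     x + (interp W ** matrix_inv (coarse_op A W Z) ** restr Z) *v (b - A *v x)"

definition F_relaxation ::
  "real^('f::finite + 'c::finite)^('f + 'c) \<Rightarrow> real^('f + 'c) \<Rightarrow> real^'f^'f
     \<Rightarrow> real^('f + 'c) \<Rightarrow> real^('f + 'c)" where
  "F_relaxation A b \<Delta>F x = x + block_mat \<Delta>F 0 0 0 *v (b - A *v x)"

definition two_grid_step ::
  "real^('f + 'c)^('f + 'c) \<Rightarrow> real^('f + 'c) \<Rightarrow> real^'f^'f \<Rightarrow> real^'c^'f \<Rightarrow> real^'f^'c
     \<Rightarrow> real^('f + 'c) \<Rightarrow> real^('f + 'c)" where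
  "two_grid_step A b \<Delta>F W Z x = F_relaxation A b \<Delta>F (coarse_correction A b W Z x)"

lemma block_mat_blocks: "block_mat (A_ff A) (A_fc A) (A_cf A) (A_cc A) = A"
  by (simp add: vec_eq_iff block_mat_def block_col_def block_row_def
      A_ff_def A_fc_def A_cf_def A_cc_def split: sum.split)

lemma sum_UNIV_Plus:
  "sum g (UNIV :: ('a::finite + 'b::finite) set) = (\<Sum>i\<in>UNIV. g (Inl i)) + (\<Sum>i\<in>UNIV. g (Inr i))"
  by (simp add: UNIV_Plus_UNIV[symmetric] sum.Plus o_def del: UNIV_Plus_UNIV)

lemma block_row_mult_block_col: "block_row B C ** block_col D E = B ** D + C ** E"
  by (simp add: vec_eq_iff matrix_matrix_mult_def block_row_def block_col_def sum_UNIV_Plus)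

lemma mult_block_row: "M ** block_row B C = block_row (M ** B) (M ** C)"
  by (simp add: vec_eq_iff matrix_matrix_mult_def block_row_def split: sum.split)

lemma block_row_add: "block_row B C + block_row D E = block_row (B + D) (C + E)"
  by (simp add: vec_eq_iff block_row_def split: sum.split)

lemma matrix_add_mult_distrib:
  fixes B C :: "real^'n^'m"
  shows "(B + C) ** D = B ** D + C ** D"
  by (simp add: vec_eq_iff matrix_matrix_mult_def sum.distrib ring_distribs)

lemma coarse_op_expand:
  "coarse_op A W Z = Z ** A_ff A ** W + A_cf A ** W + Z ** A_fc A + A_cc A"
proof -
  have "coarse_op A W Z =
      restr Z ** block_mat (A_ff A) (A_fc A) (A_cf A) (A_cc A) ** interp W"
    by (simp add: coarse_op_def block_mat_blocks)
  then show ?thesis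
    by (simp add: restr_def interp_def block_mat_def block_row_mult_block_col mult_block_row
        block_row_add matrix_add_mult_distrib algebra_simps)
qed

end

theory Submission
  imports Defs
begin

text \<open>
  The idea is that the two-grid method moves all of the information in the error through a
  quantity that lives on the F-points only. Since the coarse-grid correction annihilates the
  range of the interpolation \<open>P = [W; I]\<close>, and every vector \<open>e\<close> is the sum of the element
  \<open>P e\<^sub>c\<close> of that range and the vector \<open>e\<^sub>f - W e\<^sub>c\<close> on the F-points, one step factors through
  the short and wide matrix \<open>V = [I, -W]\<close>: the error propagation matrix is \<open>U V\<close> for some
  tall \<open>U\<close>. Powers of such a product telescope, \<open>(U V)^k = U (V U)^(k-1) V\<close> for \<open>k \<ge> 1\<close>,
  so the growth is governed by the small matrix \<open>V U\<close>, and a computation shows \<open>V U = G\<close>.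
  Submultiplicativity of the operator norm then gives the bound with the constants
  \<open>opnorm U\<close> and \<open>opnorm V\<close>, and convergence follows from \<open>opnorm G < 1\<close>.

  The residual is treated dually. There the restriction \<open>R = [Z, I]\<close> annihilates every residual
  after the coarse-grid correction, so such a residual has the form \<open>[y; -Z y]\<close> and is
  determined by its F-part \<open>y\<close>. This gives another factorization \<open>U' V'\<close>. The invertible matrix
  \<open>\<Delta>F\<close> is moved from one factor to the other, as \<open>y = inv \<Delta>F (\<Delta>F y)\<close>: the product \<open>U' V'\<close>
  stays the same, while the swapped product \<open>V' U'\<close> becomes \<open>G\<close> itself instead of a matrix
  similar to it.

  The telescoping argument is \<open>norm_iterate_factored_le\<close>. The factorizations are
  \<open>two_grid_error_factor\<close> and \<open>two_grid_residual_factor\<close>, and the swapped products are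
  identified with \<open>G\<close> in \<open>error_factors_swapped\<close> and \<open>residual_factors_swapped\<close>.
\<close>

section \<open>Arithmetic of rectangular and partitioned matrices\<close>

lemma matrix_diff_ldistrib:
  fixes B C :: "real^'n^'m"
  shows "D ** (B - C) = D ** B - D ** C"
  by (simp add: vec_eq_iff matrix_matrix_mult_def sum_subtractf ring_distribs)

lemma matrix_diff_rdistrib:
  fixes B C :: "real^'n^'m"
  shows "(B - C) ** D = B ** D - C ** D"
  by (simp add: vec_eq_iff matrix_matrix_mult_def sum_subtractf ring_distribs)

lemma matrix_minus_mult_left:
  fixes B :: "real^'n^'m"
  shows "(- B) ** D = - (B ** D)"
  by (simp add: vec_eq_iff matrix_matrix_mult_def sum_negf)

lemma matrix_minus_mult_right:
  fixes B :: "real^'n^'m"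
  shows "D ** (- B) = - (D ** B)"
  by (simp add: vec_eq_iff matrix_matrix_mult_def sum_negf)

lemma matrix_zero_mult_left: "(0 :: real^'n^'m) ** D = 0"
  by (simp add: vec_eq_iff matrix_matrix_mult_def)

lemma matrix_zero_mult_right: "D ** (0 :: real^'n^'m) = 0"
  by (simp add: vec_eq_iff matrix_matrix_mult_def)

lemma
  assumes "invertible A"
  shows matrix_inv_right: "A ** matrix_inv A = mat 1"
    and matrix_inv_left: "matrix_inv A ** A = mat 1"
  using someI_ex[OF assms[unfolded invertible_def]] by (simp_all add: matrix_inv_def)

lemmas matrix_distribs =
  matrix_add_ldistrib matrix_add_mult_distrib matrix_diff_ldistrib matrix_diff_rdistrib
  matrix_minus_mult_left matrix_minus_mult_right matrix_zero_mult_left matrix_zero_mult_right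
  matrix_mul_assoc

lemma block_col_mult: "block_col B C ** D = block_col (B ** D) (C ** D)"
  by (simp add: vec_eq_iff matrix_matrix_mult_def block_col_def split: sum.split)

lemma block_col_mult_block_row:
  "block_col B C ** block_row D E = block_mat (B ** D) (B ** E) (C ** D) (C ** E)"
  by (subst block_col_mult) (simp add: mult_block_row block_mat_def)

lemma block_mat_mult_block_col:
  "block_mat M11 M12 M21 M22 ** block_col B C =
    block_col (M11 ** B + M12 ** C) (M21 ** B + M22 ** C)"
  by (simp add: block_mat_def block_col_mult block_row_mult_block_col)

lemma block_row_mult_block_mat:
  "block_row B C ** block_mat M11 M12 M21 M22 =
    block_row (B ** M11 + C ** M21) (B ** M12 + C ** M22)"
  by (simp add: block_mat_def block_row_mult_block_col mult_block_row block_row_add)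

lemma block_mat_mult_block_mat:
  "block_mat M11 M12 M21 M22 ** block_mat N11 N12 N21 N22 =
    block_mat (M11 ** N11 + M12 ** N21) (M11 ** N12 + M12 ** N22)
              (M21 ** N11 + M22 ** N21) (M21 ** N12 + M22 ** N22)"
  by (simp only: block_mat_def[of N11] block_mat_def[of "M11 ** N11 + M12 ** N21"]
      block_mat_mult_block_col mult_block_row block_row_add)

lemma mat_1_block_mat: "mat 1 = block_mat (mat 1) 0 0 (mat 1)"
  by (simp add: vec_eq_iff mat_def block_mat_def block_col_def block_row_def split: sum.split)

lemma block_mat_diff:
  "block_mat M11 M12 M21 M22 - block_mat N11 N12 N21 N22 =
    block_mat (M11 - N11) (M12 - N12) (M21 - N21) (M22 - N22)"
  by (simp add: vec_eq_iff block_mat_def block_col_def block_row_def split: sum.split)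

section \<open>Iterations whose matrix is a factored product\<close>

text \<open>The compressed iterates \<open>V e\<^sub>k\<close> obey the recursion \<open>V e\<^sub>k\<^sub>+\<^sub>1 = (V U) V e\<^sub>k\<close>, so they
  contract with the norm of the swapped product; \<open>e\<^sub>k = U (V e\<^sub>k\<^sub>-\<^sub>1)\<close> recovers the full
  iterate, which is why one power of the rate is lost.\<close>

lemma norm_iterate_factored_le:
  fixes U :: "real^'m^'n" and V :: "real^'n^'m" and e :: "nat \<Rightarrow> real^'n"
  assumes step: "\<And>k. e (Suc k) = (U ** V) *v e k" and "k \<ge> 1"
  shows "norm (e k) \<le> opnorm (V ** U) ^ (k - 1) * opnorm U * opnorm V * norm (e 0)"
proof -
  have V_iter: "norm (V *v e k) \<le> opnorm (V ** U) ^ k * (opnorm V * norm (e 0))" for k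
  proof (induction k)
    case 0
    show ?case by (simp add: onorm)
  next
    case (Suc k)
    have "norm (V *v e (Suc k)) = norm ((V ** U) *v (V *v e k))"
      by (simp add: step matrix_vector_mul_assoc matrix_mul_assoc)
    also have "\<dots> \<le> opnorm (V ** U) * norm (V *v e k)"
      by (simp add: onorm)
    also have "\<dots> \<le> opnorm (V ** U) * (opnorm (V ** U) ^ k * (opnorm V * norm (e 0)))"
      by (intro mult_left_mono Suc.IH onorm_pos_le) simp
    finally show ?case by (simp add: mult.assoc)
  qed
  obtain j where k: "k = Suc j" using \<open>k \<ge> 1\<close> by (cases k) auto
  have "norm (e k) = norm (U *v (V *v e j))"
    by (simp add: k step matrix_vector_mul_assoc)
  also have "\<dots> \<le> opnorm U * norm (V *v e j)"
    by (simp add: onorm)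
  also have "\<dots> \<le> opnorm U * (opnorm (V ** U) ^ j * (opnorm V * norm (e 0)))"
    by (intro mult_left_mono V_iter onorm_pos_le) simp
  finally show ?thesis by (simp add: k mult_ac)
qed

lemma iterate_factored_tendsto_0:
  fixes U :: "real^'m^'n" and V :: "real^'n^'m" and e :: "nat \<Rightarrow> real^'n"
  assumes step: "\<And>k. e (Suc k) = (U ** V) *v e k" and contr: "opnorm (V ** U) < 1"
  shows "e \<longlonglongrightarrow> 0"
proof -
  let ?C = "opnorm U * opnorm V * norm (e 0)"
  have "opnorm (V ** U) \<ge> 0" by (simp add: onorm_pos_le)
  then have lim: "(\<lambda>k. opnorm (V ** U) ^ k * ?C) \<longlonglongrightarrow> 0"
    using contr by (intro tendsto_mult_left_zero LIMSEQ_realpow_zero)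
  have "norm (e (Suc k)) \<le> opnorm (V ** U) ^ k * ?C" for k
    using norm_iterate_factored_le[of e U V "Suc k", OF step] by (simp add: mult_ac)
  then have "\<forall>\<^sub>F k in sequentially. norm (e (Suc k)) \<le> opnorm (V ** U) ^ k * ?C"
    by (intro always_eventually allI)
  then have "(\<lambda>k. e (Suc k)) \<longlonglongrightarrow> 0"
    using lim by (rule Lim_null_comparison)
  then show ?thesis by (rule LIMSEQ_imp_Suc)
qed

section \<open>Error and residual propagation of a correction step\<close>

text \<open>Coarse-grid correction and F-relaxation both add \<open>M\<close> times the residual for some matrix
  \<open>M\<close>, so the next two lemmas serve for both.\<close>

lemma correction_error:
  fixes A M :: "real^'n^'n"
  assumes "invertible A"
  shows "matrix_inv A *v b - (x + M *v (b - A *v x)) =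
    (mat 1 - M ** A) *v (matrix_inv A *v b - x)"
proof -
  have "A *v (matrix_inv A *v b) = b"
    using assms by (simp add: matrix_vector_mul_assoc matrix_inv_right)
  then show ?thesis
    by (simp add: matrix_vector_mult_diff_distrib matrix_vector_mult_diff_rdistrib
        matrix_vector_mul_assoc[symmetric])
qed

lemma correction_residual:
  fixes A M :: "real^'n^'n"
  shows "b - A *v (x + M *v (b - A *v x)) = (mat 1 - A ** M) *v (b - A *v x)"
  by (simp only: matrix_vector_right_distrib matrix_vector_mult_diff_rdistrib
      matrix_vector_mul_assoc matrix_vector_mul_lid diff_diff_eq)

section \<open>Factorizations of the two-grid propagators\<close>

text \<open>The coarse-grid block of \<open>R A\<close> is expressed through \<open>K = R A P\<close>, and dually that of
  \<open>A P\<close>. In this form a multiplication by the inverse of \<open>K\<close> produces the identity block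
  that cancels in the propagators.\<close>

lemma restr_mult_A:
  "restr Z ** A = block_row (delta_R A Z) (coarse_op A W Z - delta_R A Z ** W)"
proof -
  have "restr Z ** A = restr Z ** block_mat (A_ff A) (A_fc A) (A_cf A) (A_cc A)"
    by (simp add: block_mat_blocks)
  then show ?thesis
    by (simp add: restr_def block_row_mult_block_mat delta_R_def coarse_op_expand matrix_distribs)
qed

lemma A_mult_interp:
  "A ** interp W = block_col (delta_P A W) (coarse_op A W Z - Z ** delta_P A W)"
proof -
  have "A ** interp W = block_mat (A_ff A) (A_fc A) (A_cf A) (A_cc A) ** interp W"
    by (simp add: block_mat_blocks)
  then show ?thesis
    by (simp add: interp_def block_mat_mult_block_col delta_P_def coarse_op_expand matrix_distribs)
qed

text \<open>The factor \<open>[I, -W]\<close> appears because the correction maps the range of the interpolation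
  to zero; it vanishes on exactly that range.\<close>

lemma coarse_error_factor:
  fixes A :: "real^('f::finite + 'c::finite)^('f + 'c)"
  assumes K: "invertible (coarse_op A W Z)"
  defines "S \<equiv> matrix_inv (coarse_op A W Z) ** delta_R A Z"
  shows "mat 1 - interp W ** matrix_inv (coarse_op A W Z) ** restr Z ** A =
    block_col (mat 1 - W ** S) (- S) ** block_row (mat 1) (- W)"
proof -
  have "matrix_inv (coarse_op A W Z) ** (restr Z ** A) = block_row S (mat 1 - S ** W)"
    using K by (simp add: restr_mult_A[of Z A W] mult_block_row matrix_diff_ldistrib
        matrix_inv_left S_def matrix_mul_assoc)
  then have "interp W ** matrix_inv (coarse_op A W Z) ** restr Z ** A =
      interp W ** block_row S (mat 1 - S ** W)"
    by (simp flip: matrix_mul_assoc)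
  then show ?thesis
    by (simp add: interp_def mat_1_block_mat block_col_mult_block_row block_mat_diff
        matrix_distribs)
qed

text \<open>The factor \<open>[I; -Z]\<close> appears because the restriction of the residual is zero after the
  correction; its range is exactly the kernel of the restriction.\<close>

lemma coarse_residual_factor:
  fixes A :: "real^('f::finite + 'c::finite)^('f + 'c)"
  assumes K: "invertible (coarse_op A W Z)"
  defines "T \<equiv> delta_P A W ** matrix_inv (coarse_op A W Z)"
  shows "mat 1 - A ** (interp W ** matrix_inv (coarse_op A W Z) ** restr Z) =
    block_col (mat 1) (- Z) ** block_row (mat 1 - T ** Z) (- T)"
proof -
  have "A ** interp W ** matrix_inv (coarse_op A W Z) = block_col T (mat 1 - Z ** T)"
    using K by (simp add: A_mult_interp[of A W Z] block_col_mult matrix_diff_rdistrib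
        matrix_inv_right T_def matrix_mul_assoc)
  then have "A ** (interp W ** matrix_inv (coarse_op A W Z) ** restr Z) =
      block_col T (mat 1 - Z ** T) ** restr Z"
    by (simp add: matrix_mul_assoc)
  then show ?thesis
    by (simp add: restr_def mat_1_block_mat block_col_mult_block_row block_mat_diff
        matrix_distribs)
qed

lemma F_relaxation_error_matrix:
  "mat 1 - block_mat \<Delta>F 0 0 0 ** A = block_mat (delta_F A \<Delta>F) (- (\<Delta>F ** A_fc A)) 0 (mat 1)"
proof -
  have "block_mat \<Delta>F 0 0 0 ** A =
      block_mat \<Delta>F 0 0 0 ** block_mat (A_ff A) (A_fc A) (A_cf A) (A_cc A)"
    by (simp add: block_mat_blocks)
  then show ?thesis
    by (simp add: mat_1_block_mat block_mat_mult_block_mat block_mat_diff delta_F_def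
        matrix_zero_mult_left)
qed

lemma F_relaxation_residual_matrix:
  "mat 1 - A ** block_mat \<Delta>F 0 0 0 =
    block_mat (mat 1 - A_ff A ** \<Delta>F) 0 (- (A_cf A ** \<Delta>F)) (mat 1)"
proof -
  have "A ** block_mat \<Delta>F 0 0 0 =
      block_mat (A_ff A) (A_fc A) (A_cf A) (A_cc A) ** block_mat \<Delta>F 0 0 0"
    by (simp add: block_mat_blocks)
  then show ?thesis
    by (simp add: mat_1_block_mat block_mat_mult_block_mat block_mat_diff matrix_zero_mult_right)
qed

lemma two_grid_error_factor:
  fixes A :: "real^('f::finite + 'c::finite)^('f + 'c)"
  assumes "invertible (coarse_op A W Z)"
  defines "S \<equiv> matrix_inv (coarse_op A W Z) ** delta_R A Z"
  shows "(mat 1 - block_mat \<Delta>F 0 0 0 ** A) **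
      (mat 1 - interp W ** matrix_inv (coarse_op A W Z) ** restr Z ** A) =
    block_col (delta_F A \<Delta>F - W_hat A \<Delta>F W ** S) (- S) ** block_row (mat 1) (- W)"
proof -
  have "block_mat (delta_F A \<Delta>F) (- (\<Delta>F ** A_fc A)) 0 (mat 1) **
        block_col (mat 1 - W ** S) (- S) =
      block_col (delta_F A \<Delta>F - W_hat A \<Delta>F W ** S) (- S)"
    by (simp add: block_mat_mult_block_col W_hat_def matrix_distribs algebra_simps)
  then show ?thesis
    by (simp only: coarse_error_factor[OF assms(1), folded S_def] F_relaxation_error_matrix
        matrix_mul_assoc)
qed

text \<open>The swapped product is \<open>\<delta>\<^sub>F + (W - W_hat) S\<close>, and
  \<open>W - W_hat = \<Delta>F A\<^sub>f\<^sub>f W + \<Delta>F A\<^sub>f\<^sub>c = \<Delta>F \<delta>\<^sub>P\<close>.\<close>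

lemma error_factors_swapped:
  fixes S :: "real^'f::finite^'c::finite"
  assumes "S = matrix_inv (coarse_op A W Z) ** delta_R A Z"
  shows "block_row (mat 1) (- W) ** block_col (delta_F A \<Delta>F - W_hat A \<Delta>F W ** S) (- S) =
    G_mat A \<Delta>F W Z"
  by (simp add: assms block_row_mult_block_col W_hat_def G_mat_def delta_F_def delta_P_def
      matrix_distribs)

text \<open>Relaxation turns \<open>[I; -Z]\<close> into \<open>[I - A\<^sub>f\<^sub>f \<Delta>F; -(A\<^sub>c\<^sub>f \<Delta>F + Z)]\<close>. A factor \<open>\<Delta>F\<close> is
  split off on its right and absorbed into the row factor.\<close>

lemma two_grid_residual_factor:
  fixes A :: "real^('f::finite + 'c::finite)^('f + 'c)"
  assumes "invertible (coarse_op A W Z)" and "invertible \<Delta>F"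
  defines "T \<equiv> delta_P A W ** matrix_inv (coarse_op A W Z)"
  shows "(mat 1 - A ** block_mat \<Delta>F 0 0 0) **
      (mat 1 - A ** (interp W ** matrix_inv (coarse_op A W Z) ** restr Z)) =
    block_col (matrix_inv \<Delta>F - A_ff A) (- (Z ** matrix_inv \<Delta>F + A_cf A)) **
    block_row (\<Delta>F ** (mat 1 - T ** Z)) (- (\<Delta>F ** T))"
proof -
  have "X ** matrix_inv \<Delta>F ** \<Delta>F = X" for X :: "real^'f^'c"
    using assms(2) by (simp add: matrix_inv_left flip: matrix_mul_assoc)
  then have "block_mat (mat 1 - A_ff A ** \<Delta>F) 0 (- (A_cf A ** \<Delta>F)) (mat 1) **
        block_col (mat 1) (- Z) =
      block_col (matrix_inv \<Delta>F - A_ff A) (- (Z ** matrix_inv \<Delta>F + A_cf A)) ** \<Delta>F"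
    using assms(2)
    by (simp add: block_mat_mult_block_col block_col_mult matrix_distribs matrix_inv_left
        minus_diff_commute)
  moreover have "\<Delta>F ** block_row (mat 1 - T ** Z) (- T) =
      block_row (\<Delta>F ** (mat 1 - T ** Z)) (- (\<Delta>F ** T))"
    by (simp only: mult_block_row matrix_minus_mult_right)
  ultimately show ?thesis
    by (metis coarse_residual_factor[OF assms(1), folded T_def] F_relaxation_residual_matrix
        matrix_mul_assoc)
qed

text \<open>The terms \<open>\<Delta>F T Z (inv \<Delta>F)\<close> coming from the two blocks cancel, which leaves
  \<open>I - \<Delta>F A\<^sub>f\<^sub>f + \<Delta>F T (Z A\<^sub>f\<^sub>f + A\<^sub>c\<^sub>f)\<close>.\<close>

lemma residual_factors_swapped:
  fixes A :: "real^('f::finite + 'c::finite)^('f + 'c)"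
  assumes "invertible \<Delta>F"
    and "T = delta_P A W ** matrix_inv (coarse_op A W Z)"
  shows "block_row (\<Delta>F ** (mat 1 - T ** Z)) (- (\<Delta>F ** T)) **
    block_col (matrix_inv \<Delta>F - A_ff A) (- (Z ** matrix_inv \<Delta>F + A_cf A)) = G_mat A \<Delta>F W Z"
  using assms(1)
  by (simp add: assms(2) block_row_mult_block_col G_mat_def delta_F_def delta_R_def
      matrix_distribs matrix_inv_right)

section \<open>Convergence of the two-grid iteration\<close>

lemma two_grid_step_error:
  assumes "invertible A" and "invertible (coarse_op A W Z)"
  defines "S \<equiv> matrix_inv (coarse_op A W Z) ** delta_R A Z"
  shows "matrix_inv A *v b - two_grid_step A b \<Delta>F W Z x =
    (block_col (delta_F A \<Delta>F - W_hat A \<Delta>F W ** S) (- S) ** block_row (mat 1) (- W))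
      *v (matrix_inv A *v b - x)"
  using two_grid_error_factor[OF assms(2), of \<Delta>F]
  by (simp add: two_grid_step_def F_relaxation_def coarse_correction_def S_def
      correction_error[OF assms(1)] matrix_vector_mul_assoc)

lemma two_grid_step_residual:
  assumes "invertible (coarse_op A W Z)" and "invertible \<Delta>F"
  defines "T \<equiv> delta_P A W ** matrix_inv (coarse_op A W Z)"
  shows "b - A *v two_grid_step A b \<Delta>F W Z x =
    (block_col (matrix_inv \<Delta>F - A_ff A) (- (Z ** matrix_inv \<Delta>F + A_cf A)) **
      block_row (\<Delta>F ** (mat 1 - T ** Z)) (- (\<Delta>F ** T))) *v (b - A *v x)"
proof -
  have "b - A *v two_grid_step A b \<Delta>F W Z x =
      (mat 1 - A ** block_mat \<Delta>F 0 0 0) *v (b - A *v coarse_correction A b W Z x)"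
    by (simp only: two_grid_step_def F_relaxation_def correction_residual)
  also have "b - A *v coarse_correction A b W Z x =
      (mat 1 - A ** (interp W ** matrix_inv (coarse_op A W Z) ** restr Z)) *v (b - A *v x)"
    by (simp only: coarse_correction_def correction_residual)
  finally show ?thesis
    by (simp only: matrix_vector_mul_assoc two_grid_residual_factor[OF assms(1,2)] T_def)
qed

theorem lemma3p1:
  fixes A :: "real^('f::finite + 'c::finite)^('f + 'c)"
    and W :: "real^'c^'f" and Z :: "real^'f^'c" and \<Delta>F :: "real^'f^'f"
    and b :: "real^('f + 'c)" and x :: "nat \<Rightarrow> real^('f + 'c)"
    and \<rho> :: real
  assumes "invertible A"
    and "invertible (A_ff A)"
    and "invertible \<Delta>F"
    and "invertible (coarse_op A W Z)"
    and "opnorm (G_mat A \<Delta>F W Z) = \<rho>"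
    and "\<rho> < 1"
    and "\<And>k. x (Suc k) = two_grid_step A b \<Delta>F W Z (x k)"
  shows "x \<longlonglongrightarrow> matrix_inv A *v b \<and>
    (\<forall>k\<ge>1. norm (matrix_inv A *v b - x k) \<le>
      \<rho> ^ (k - 1)
      * opnorm (block_col
          (delta_F A \<Delta>F - W_hat A \<Delta>F W ** matrix_inv (coarse_op A W Z) ** delta_R A Z)
          (- (matrix_inv (coarse_op A W Z) ** delta_R A Z)))
      * opnorm (block_row (mat 1) (- W))
      * norm (matrix_inv A *v b - x 0)) \<and>
    (\<forall>k\<ge>1. norm (b - A *v x k) \<le>
      \<rho> ^ (k - 1)
      * opnorm (block_col
          (matrix_inv \<Delta>F - A_ff A)
          (- (Z ** matrix_inv \<Delta>F + A_cf A)))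
      * opnorm (block_row
          (\<Delta>F ** (mat 1 - delta_P A W ** matrix_inv (coarse_op A W Z) ** Z))
          (- (\<Delta>F ** delta_P A W ** matrix_inv (coarse_op A W Z))))
      * norm (b - A *v x 0))"
proof -
  let ?S = "matrix_inv (coarse_op A W Z) ** delta_R A Z"
  let ?T = "delta_P A W ** matrix_inv (coarse_op A W Z)"
  let ?Ue = "block_col (delta_F A \<Delta>F - W_hat A \<Delta>F W ** ?S) (- ?S)"
  let ?Ve = "block_row (mat 1) (- W)"
  let ?Ur = "block_col (matrix_inv \<Delta>F - A_ff A) (- (Z ** matrix_inv \<Delta>F + A_cf A))"
  let ?Vr = "block_row (\<Delta>F ** (mat 1 - ?T ** Z)) (- (\<Delta>F ** ?T))"
  let ?e = "\<lambda>k. matrix_inv A *v b - x k"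
  let ?r = "\<lambda>k. b - A *v x k"
  have e_step: "?e (Suc k) = (?Ue ** ?Ve) *v ?e k" for k
    using two_grid_step_error[OF assms(1,4)] by (simp add: assms(7))
  have r_step: "?r (Suc k) = (?Ur ** ?Vr) *v ?r k" for k
    using two_grid_step_residual[OF assms(4,3)] by (simp add: assms(7))
  have e_rho: "opnorm (?Ve ** ?Ue) = \<rho>"
    using assms(5) by (simp add: error_factors_swapped)
  have r_rho: "opnorm (?Vr ** ?Ur) = \<rho>"
    using assms(5) residual_factors_swapped[OF assms(3) refl, of A W Z] by simp
  have "?e \<longlonglongrightarrow> 0"
    using iterate_factored_tendsto_0[of ?e ?Ue ?Ve] e_step e_rho \<open>\<rho> < 1\<close> by simp
  then have "(\<lambda>k. matrix_inv A *v b - ?e k) \<longlonglongrightarrow> matrix_inv A *v b - 0"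
    by (intro tendsto_diff tendsto_const)
  then have "x \<longlonglongrightarrow> matrix_inv A *v b"
    by simp
  moreover have "norm (?e k) \<le> \<rho> ^ (k - 1) * opnorm ?Ue * opnorm ?Ve * norm (?e 0)"
    if "k \<ge> 1" for k
    using norm_iterate_factored_le[of ?e, OF e_step that] unfolding e_rho .
  moreover have "norm (?r k) \<le> \<rho> ^ (k - 1) * opnorm ?Ur * opnorm ?Vr * norm (?r 0)"
    if "k \<ge> 1" for k
    using norm_iterate_factored_le[of ?r, OF r_step that] unfolding r_rho .
  ultimately show ?thesis
    \<comment> \<open>Products inside the factors are bracketed to the right above, to the left in the claim.\<close>
    by (simp only: matrix_mul_assoc) blast
qed

end
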